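(* Let $X\subseteq\mathbb{R}^n$ be a convex set that is either open in $\mathbb{R}^n$ or a polyhedron, and let $\succcurlyeq$ be a binary relation on $X$ with asymmetric part $\succ$ and symmetric part $\sim$. Then $\succcurlyeq$ is linearly continuous if and only if it is continuous, provided that any one of the following holds: (a) $\succcurlyeq$ is complete, and $\succcurlyeq$ and $\succ$ have locally convex upper sections; (b) $\succcurlyeq$ and $\succ$ have locally convex sections (both upper and lower); (c) $\succcurlyeq$ is reflexive and demonstrates convex indifference, and $\sim$ is transitive.
   Context: A polyhedron is an intersection of finitely many closed half-spaces of $\mathbb{R}^n$. For a binary relation $\succcurlyeq$ on $X$: $x\succ y$ iff $x\succcurlyeq y$ and not $y\succcurlyeq x$; $x\sim y$ iff $x\succcurlyeq y$ and $y\succcurlyeq x$; $x\preccurlyeq y$ iff $y\succcurlyeq x$; $x\prec y$ iff $y\succ x$. Complete: $x\succcurlyeq y$ or $y\succcurlyeq x$ for all $x,y\in X$. For $R\in\{\succcurlyeq,\preccurlyeq,\succ,\prec\}$, $A_R(x)=\{y\in X: y\,R\,x\}$. The upper sections of $\succcurlyeq$ (resp. $\succ$) are the sets $A_\succcurlyeq(x)$ (resp. $A_\succ(x)$), $x\in X$; the lower sections are $A_\preccurlyeq(x)$ (resp. $A_\prec(x)$), $x\in X$. A set $Y\subseteq\mathbb{R}^n$ is locally convex if each point of its closure $\mathrm{cl}\,Y$ has a convex open neighborhood whose intersection with $Y$ is convex. $\succcurlyeq$ demonstrates convex indifference if for all $x,y\in X$ and $\lambda\in(0,1)$, $x\sim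 y$ implies $x\sim \lambda x+(1-\lambda)y$. Continuous: for all $x\in X$, $A_\succcurlyeq(x)$ and $A_\preccurlyeq(x)$ are closed in $X$, and $A_\succ(x)$ and $A_\prec(x)$ are open in $X$. Linearly continuous: for every straight line $L$ in $X$ (the intersection with $X$ of a one-dimensional affine subspace contained in the affine hull of $X$) and all $x\in X$ (not only $x\in L$), $A_\succcurlyeq(x)\cap L$ and $A_\preccurlyeq(x)\cap L$ are closed in $L$, and $A_\succ(x)\cap L$ and $A_\prec(x)\cap L$ are open in $L$. *)

theory Defs
  imports "HOL-Analysis.Analysis"
begin

text \<open>A binary relation on \<open>X\<close> is given by a predicate \<open>R\<close> on the whole space.
  Every notion below looks only at the values of \<open>R\<close> on \<open>X\<close>, so the values elsewhere are
  immaterial. \<open>R x y\<close> reads: \<open>x\<close> is weakly preferred to \<open>y\<close>.\<close>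

definition strict_part :: "('a \<Rightarrow> 'a \<Rightarrow> bool) \<Rightarrow> 'a \<Rightarrow> 'a \<Rightarrow> bool" where
  "strict_part R x y \<longleftrightarrow> R x y \<and> \<not> R y x"

definition indiff_part :: "('a \<Rightarrow> 'a \<Rightarrow> bool) \<Rightarrow> 'a \<Rightarrow> 'a \<Rightarrow> bool" where
  "indiff_part R x y \<longleftrightarrow> R x y \<and> R y x"

text \<open>The library's \<open>totalp_on\<close> says nothing about the case \<open>x = y\<close>; completeness includes it,
  so a complete relation is reflexive.\<close>

definition complete_on :: "'a set \<Rightarrow> ('a \<Rightarrow> 'a \<Rightarrow> bool) \<Rightarrow> bool" where
  "complete_on X R \<longleftrightarrow> (\<forall>x\<in>X. \<forall>y\<in>X. R x y \<or> R y x)"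

definition upper_section :: "'a set \<Rightarrow> ('a \<Rightarrow> 'a \<Rightarrow> bool) \<Rightarrow> 'a \<Rightarrow> 'a set" where
  "upper_section X R x = {y \<in> X. R y x}"

definition lower_section :: "'a set \<Rightarrow> ('a \<Rightarrow> 'a \<Rightarrow> bool) \<Rightarrow> 'a \<Rightarrow> 'a set" where
  "lower_section X R x = {y \<in> X. R x y}"

text \<open>The closure is taken in the whole space, not in \<open>X\<close>.\<close>

definition locally_convex :: "'a::euclidean_space set \<Rightarrow> bool" where
  "locally_convex Y \<longleftrightarrow>
     (\<forall>y \<in> closure Y. \<exists>U. open U \<and> convex U \<and> y \<in> U \<and> convex (U \<inter> Y))"

definition locally_convex_upper_sections ::
    "'a::euclidean_space set \<Rightarrow> ('a \<Rightarrow> 'a \<Rightarrow> bool) \<Rightarrow> bool" where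
  "locally_convex_upper_sections X R \<longleftrightarrow> (\<forall>x\<in>X. locally_convex (upper_section X R x))"

definition locally_convex_lower_sections ::
    "'a::euclidean_space set \<Rightarrow> ('a \<Rightarrow> 'a \<Rightarrow> bool) \<Rightarrow> bool" where
  "locally_convex_lower_sections X R \<longleftrightarrow> (\<forall>x\<in>X. locally_convex (lower_section X R x))"

definition convex_indifference ::
    "'a::euclidean_space set \<Rightarrow> ('a \<Rightarrow> 'a \<Rightarrow> bool) \<Rightarrow> bool" where
  "convex_indifference X R \<longleftrightarrow>
     (\<forall>x\<in>X. \<forall>y\<in>X. \<forall>l::real. 0 < l \<and> l < 1 \<longrightarrow> indiff_part R x y \<longrightarrow>
        indiff_part R x (l *\<^sub>R x + (1 - l) *\<^sub>R y))"

definition continuous_pref ::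
    "'a::euclidean_space set \<Rightarrow> ('a \<Rightarrow> 'a \<Rightarrow> bool) \<Rightarrow> bool" where
  "continuous_pref X R \<longleftrightarrow>
     (\<forall>x\<in>X.
        closedin (top_of_set X) (upper_section X R x) \<and>
        closedin (top_of_set X) (lower_section X R x) \<and>
        openin (top_of_set X) (upper_section X (strict_part R) x) \<and>
        openin (top_of_set X) (lower_section X (strict_part R) x))"

definition straight_line_in :: "'a::euclidean_space set \<Rightarrow> 'a set \<Rightarrow> bool" where
  "straight_line_in X L \<longleftrightarrow>
     (\<exists>M. affine M \<and> aff_dim M = 1 \<and> M \<subseteq> affine hull X \<and> L = M \<inter> X)"

text \<open>The point \<open>x\<close> ranges over all of \<open>X\<close>, not only over the line \<open>L\<close>.\<close>

definition linearly_continuous_pref ::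
    "'a::euclidean_space set \<Rightarrow> ('a \<Rightarrow> 'a \<Rightarrow> bool) \<Rightarrow> bool" where
  "linearly_continuous_pref X R \<longleftrightarrow>
     (\<forall>L. straight_line_in X L \<longrightarrow> (\<forall>x\<in>X.
        closedin (top_of_set L) (upper_section X R x \<inter> L) \<and>
        closedin (top_of_set L) (lower_section X R x \<inter> L) \<and>
        openin (top_of_set L) (upper_section X (strict_part R) x \<inter> L) \<and>
        openin (top_of_set L) (lower_section X (strict_part R) x \<inter> L)))"

end

theory Submission
  imports Defs
begin

text \<open>If \<open>x\<close> is in the closure of a locally convex set \<open>Y\<close>, then near \<open>x\<close> the set is convex, and
  the half-open segment from a relative interior point to \<open>x\<close> lies in \<open>Y\<close>; hence closedness along
  lines already gives \<open>x \<in> Y\<close>. For openness at \<open>y \<in> Y\<close>, choose a polytope in \<open>X\<close> that agrees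
  with \<open>X\<close> near \<open>y\<close> and shrink it towards \<open>y\<close> until its finitely many vertices lie in the convex
  part of \<open>Y\<close>; since a polyhedron is a cone near each of its points, the shrunken polytope is still
  a neighbourhood of \<open>y\<close> in \<open>X\<close>.

  Under convex indifference every indifference class is convex, hence closed in \<open>X\<close>, and off the
  class of \<open>x\<close> the strict sections at \<open>x\<close> are open and closed along segments, hence locally
  constant.\<close>

section \<open>Closedness and openness along lines\<close>

text \<open>The conditions of \<open>linearly_continuous_pref\<close> for a single set, so that the
  topology can be treated apart from any relation. The inclusion in \<open>X\<close> holds for every
  section.\<close>

definition linearly_closedin :: "'a::euclidean_space set \<Rightarrow> 'a set \<Rightarrow> bool" where
  "linearly_closedin X Y \<longleftrightarrow>
     Y \<subseteq> X \<and> (\<forall>L. straight_line_in X L \<longrightarrow> closedin (top_of_set L) (Y \<inter> L))"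

definition linearly_openin :: "'a::euclidean_space set \<Rightarrow> 'a set \<Rightarrow> bool" where
  "linearly_openin X Y \<longleftrightarrow>
     Y \<subseteq> X \<and> (\<forall>L. straight_line_in X L \<longrightarrow> openin (top_of_set L) (Y \<inter> L))"

lemma straight_line_in_subset: "straight_line_in X L \<Longrightarrow> L \<subseteq> X"
  unfolding straight_line_in_def by blast

lemma closedin_imp_linearly_closedin:
  assumes "closedin (top_of_set X) Y"
  shows "linearly_closedin X Y"
proof -
  from assms obtain T where "closed T" and Y: "Y = X \<inter> T"
    by (auto simp: closedin_closed)
  have "closedin (top_of_set L) (Y \<inter> L)" if "L \<subseteq> X" for L
  proof -
    have "Y \<inter> L = L \<inter> T" using that Y by blast
    then show ?thesis using \<open>closed T\<close> by (simp add: closedin_closed_Int)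
  qed
  then show ?thesis
    unfolding linearly_closedin_def using Y straight_line_in_subset by blast
qed

lemma openin_imp_linearly_openin:
  assumes "openin (top_of_set X) Y"
  shows "linearly_openin X Y"
proof -
  from assms obtain T where "open T" and Y: "Y = X \<inter> T"
    by (auto simp: openin_open)
  have "openin (top_of_set L) (Y \<inter> L)" if "L \<subseteq> X" for L
  proof -
    have "Y \<inter> L = L \<inter> T" using that Y by blast
    then show ?thesis using \<open>open T\<close> by (simp add: openin_open_Int)
  qed
  then show ?thesis
    unfolding linearly_openin_def using Y straight_line_in_subset by blast
qed

lemma linearly_closedin_Int:
  assumes "linearly_closedin X Y" "linearly_closedin X Z"
  shows "linearly_closedin X (Y \<inter> Z)"
proof -
  have "(Y \<inter> Z) \<inter> L = (Y \<inter> L) \<inter> (Z \<inter> L)" for L by blast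
  then show ?thesis
    using assms unfolding linearly_closedin_def by (metis closedin_Int le_infI1)
qed

text \<open>Later arguments reach lines only through segments. Two distinct points have a
  one-dimensional affine hull, and convexity of \<open>X\<close> keeps their segment inside the
  trace of that hull on \<open>X\<close>.\<close>

lemma segment_in_straight_line:
  assumes "convex X" "a \<in> X" "b \<in> X" "a \<noteq> b"
  obtains L where "straight_line_in X L" "closed_segment a b \<subseteq> L"
proof
  let ?M = "affine hull {a, b}"
  have "?M \<subseteq> affine hull X"
    using assms by (intro hull_mono) auto
  then show "straight_line_in X (?M \<inter> X)"
    unfolding straight_line_in_def using \<open>a \<noteq> b\<close>
    by (intro exI[of _ ?M]) (simp add: aff_dim_affine_hull aff_dim_2 affine_affine_hull)
  show "closed_segment a b \<subseteq> ?M \<inter> X"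
    using closed_segment_subset[OF assms(2,3,1)] convex_hull_subset_affine_hull[of "{a, b}"]
    by (simp add: segment_convex_hull)
qed

lemma linearly_closedin_segment:
  assumes "convex X" "linearly_closedin X Y" "a \<in> X" "b \<in> X"
  shows "closedin (top_of_set (closed_segment a b)) (Y \<inter> closed_segment a b)"
proof (cases "a = b")
  \<comment> \<open>A one-point segment need not lie on a line in \<open>X\<close>, as
    \<open>X\<close> may be a single point; its subsets are closed in it anyway.\<close>
  case True
  then show ?thesis by (cases "a \<in> Y") auto
next
  case False
  then obtain L where L: "straight_line_in X L" "closed_segment a b \<subseteq> L"
    using segment_in_straight_line assms by metis
  then obtain T where T: "closed T" "Y \<inter> L = L \<inter> T"
    using assms(2) unfolding linearly_closedin_def closedin_closed by blast
  have "Y \<inter> closed_segment a b = closed_segment a b \<inter> T" using T L by blast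
  then show ?thesis using T by (simp add: closedin_closed_Int)
qed

lemma linearly_openin_segment:
  assumes "convex X" "linearly_openin X Y" "a \<in> X" "b \<in> X"
  shows "openin (top_of_set (closed_segment a b)) (Y \<inter> closed_segment a b)"
proof (cases "a = b")
  case True
  then show ?thesis by (cases "a \<in> Y") auto
next
  case False
  then obtain L where L: "straight_line_in X L" "closed_segment a b \<subseteq> L"
    using segment_in_straight_line assms by metis
  then obtain T where T: "open T" "Y \<inter> L = L \<inter> T"
    using assms(2) unfolding linearly_openin_def openin_open by blast
  have "Y \<inter> closed_segment a b = closed_segment a b \<inter> T" using T L by blast
  then show ?thesis using T by (simp add: openin_open_Int)
qed

section \<open>Closed sections from local convexity\<close>

lemma linearly_closedin_imp_closedin:
  assumes "convex X" "linearly_closedin X Y" "locally_convex Y"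
  shows "closedin (top_of_set X) Y"
proof -
  have "x \<in> Y" if x: "x \<in> X" "x \<in> closure Y" for x
  proof -
    obtain U where U: "open U" "x \<in> U" "convex (U \<inter> Y)"
      using assms(3) x unfolding locally_convex_def by blast
    have xU: "x \<in> closure (U \<inter> Y)"
      using open_Int_closure_subset[OF U(1)] U(2) x(2) by blast
    then have "U \<inter> Y \<noteq> {}" by auto
    then obtain y where y: "y \<in> rel_interior (U \<inter> Y)"
      using rel_interior_eq_empty[OF U(3)] by blast
    have yY: "y \<in> Y" using y rel_interior_subset by blast
    show ?thesis
    proof (cases "x = y")
      case False
      have sub: "open_segment y x \<subseteq> Y \<inter> closed_segment y x"
        using rel_interior_closure_convex_segment[OF U(3) y xU] rel_interior_subset
          segment_open_subset_closed by blast
      have "y \<in> X" using yY assms(2) unfolding linearly_closedin_def by blast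
      \<comment> \<open>The segment is itself closed, so closedness relative to it is closedness in
        the whole space; the closure of the open segment, which contains \<open>x\<close>, then
        stays in \<open>Y\<close>.\<close>
      then have "closed (Y \<inter> closed_segment y x)"
        using linearly_closedin_segment[OF assms(1,2)] x(1) closedin_closed_trans
          closed_segment by blast
      then have "closure (open_segment y x) \<subseteq> Y"
        using closure_minimal[OF sub] by blast
      then show ?thesis using False by auto
    qed (use yY in simp)
  qed
  then have "Y = X \<inter> closure Y"
    using closure_subset assms(2) unfolding linearly_closedin_def by blast
  then show ?thesis by (metis closed_closure closedin_closed_Int)
qed

section \<open>Polyhedra near a point and open sections\<close>

text \<open>A half-space with \<open>y\<close> on its boundary is preserved by scaling about
  \<open>y\<close> with a nonnegative factor. If \<open>y\<close> is interior to the half-space,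
  continuity keeps the scaled point inside for \<open>z\<close> near \<open>y\<close>. Only finitely
  many half-spaces have to be combined.\<close>

lemma polyhedron_locally_conic:
  assumes "polyhedron X" "y \<in> X" "0 \<le> c"
  shows "\<forall>\<^sub>F z in nhds y. z \<in> X \<longrightarrow> y + c *\<^sub>R (z - y) \<in> X"
proof -
  obtain F where F: "finite F" "X = \<Inter>F" "\<forall>h\<in>F. \<exists>a b. a \<noteq> 0 \<and> h = {x. a \<bullet> x \<le> b}"
    using assms(1) unfolding polyhedron_def by blast
  have "\<forall>\<^sub>F z in nhds y. z \<in> h \<longrightarrow> y + c *\<^sub>R (z - y) \<in> h" if hF: "h \<in> F" for h
  proof -
    obtain a b where h: "h = {x. a \<bullet> x \<le> b}" using F(3) hF by blast
    have "a \<bullet> y \<le> b" using assms(2) F(2) hF h by blast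
    then consider "a \<bullet> y = b" | "a \<bullet> y < b" by linarith
    then show ?thesis
    proof cases
      case 1
      have "a \<bullet> (y + c *\<^sub>R (z - y)) \<le> b" if "a \<bullet> z \<le> b" for z
        using 1 that mult_left_mono[of "a \<bullet> z - b" 0 c] \<open>0 \<le> c\<close>
        by (simp add: inner_add_right inner_diff_right)
      then show ?thesis by (simp add: h)
    next
      case 2
      have "((\<lambda>z. a \<bullet> (y + c *\<^sub>R (z - y))) \<longlongrightarrow> a \<bullet> (y + c *\<^sub>R (y - y))) (nhds y)"
        by (intro tendsto_intros filterlim_ident)
      then have "\<forall>\<^sub>F z in nhds y. a \<bullet> (y + c *\<^sub>R (z - y)) < b"
        using 2 by (intro order_tendstoD) auto
      then show ?thesis
        by eventually_elim (simp add: h)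
    qed
  qed
  then have "\<forall>\<^sub>F z in nhds y. \<forall>h\<in>F. z \<in> h \<longrightarrow> y + c *\<^sub>R (z - y) \<in> h"
    using F(1) by (simp add: eventually_ball_finite)
  then show ?thesis
    by eventually_elim (auto simp: F(2))
qed

text \<open>An open set contains a box around \<open>y\<close>; a polyhedron cut by a box is
  bounded, hence a polytope. The gain is a local model of \<open>X\<close> with finitely many
  vertices.\<close>

lemma polytope_neighbourhood:
  fixes X :: "'a::euclidean_space set"
  assumes "open X \<or> polyhedron X" "y \<in> X"
  obtains P where "polytope P" "P \<subseteq> X" "y \<in> P" "\<forall>\<^sub>F z in nhds y. z \<in> X \<longrightarrow> z \<in> P"
  using assms(1)
proof
  assume "open X"
  then obtain a b where ab: "y \<in> box a b" "cbox a b \<subseteq> X"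
    using open_contains_cbox[OF _ assms(2)] by metis
  have "\<forall>\<^sub>F z in nhds y. z \<in> box a b"
    using ab(1) open_box by (rule eventually_nhds_in_open[rotated])
  then have "\<forall>\<^sub>F z in nhds y. z \<in> X \<longrightarrow> z \<in> cbox a b"
    by eventually_elim (use box_subset_cbox in blast)
  then show thesis
    using that[of "cbox a b"] ab box_subset_cbox polytope_interval by blast
next
  assume "polyhedron X"
  obtain a b where ab: "y \<in> box a b"
    using open_contains_cbox[of UNIV y] by (metis UNIV_I open_UNIV)
  have "\<forall>\<^sub>F z in nhds y. z \<in> box a b"
    using ab open_box by (rule eventually_nhds_in_open[rotated])
  then have "\<forall>\<^sub>F z in nhds y. z \<in> X \<longrightarrow> z \<in> X \<inter> cbox a b"
    by eventually_elim (use box_subset_cbox in blast)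
  moreover have "polytope (X \<inter> cbox a b)"
    using \<open>polyhedron X\<close>
    by (simp add: polytope_eq_bounded_polyhedron polyhedron_Int polytope_interval bounded_Int)
  ultimately show thesis
    using that[of "X \<inter> cbox a b"] ab assms(2) box_subset_cbox by blast
qed

text \<open>For small positive \<open>t\<close> the point runs along the segment from
  \<open>y\<close> to \<open>v\<close>, on which \<open>Y\<close> is relatively open. The limit is
  one-sided because for negative \<open>t\<close> the point may leave \<open>X\<close>.\<close>

lemma linearly_openin_eventually:
  assumes "convex X" "linearly_openin X Y" "y \<in> Y" "v \<in> X"
  shows "\<forall>\<^sub>F t in at_right 0. y + t *\<^sub>R (v - y) \<in> Y"
proof -
  have "y \<in> X" using assms(2,3) unfolding linearly_openin_def by blast
  then obtain T where T: "open T" "Y \<inter> closed_segment y v = closed_segment y v \<inter> T"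
    using linearly_openin_segment[OF assms(1,2) _ assms(4)] unfolding openin_open by blast
  then have "y \<in> T" using assms(3) ends_in_segment by blast
  have "((\<lambda>t. y + t *\<^sub>R (v - y)) \<longlongrightarrow> y + 0 *\<^sub>R (v - y)) (at_right 0)"
    by (intro tendsto_intros)
  then have "\<forall>\<^sub>F t in at_right 0. y + t *\<^sub>R (v - y) \<in> T"
    by (rule topological_tendstoD) (use T \<open>y \<in> T\<close> in auto)
  moreover have "\<forall>\<^sub>F t::real in at_right 0. 0 < t \<and> t < 1"
    using eventually_at_right_real[of 0 "1::real"] by simp
  ultimately show ?thesis
  proof eventually_elim
    case (elim t)
    have "y + t *\<^sub>R (v - y) = (1 - t) *\<^sub>R y + t *\<^sub>R v" by (simp add: algebra_simps)
    then have "y + t *\<^sub>R (v - y) \<in> closed_segment y v"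
      using elim unfolding closed_segment_def by auto
    then show ?case using T elim by blast
  qed
qed

lemma linearly_openin_imp_openin:
  assumes "convex X" "open X \<or> polyhedron X" "linearly_openin X Y" "locally_convex Y"
  shows "openin (top_of_set X) Y"
proof -
  have YX: "Y \<subseteq> X" using assms(3) unfolding linearly_openin_def by blast
  have nhds: "\<forall>\<^sub>F z in nhds y. z \<in> X \<longrightarrow> z \<in> Y" if y: "y \<in> Y" for y
  proof -
    obtain W where W: "open W" "y \<in> W" "convex (W \<inter> Y)"
      using assms(4) y closure_subset unfolding locally_convex_def by blast
    obtain P where P: "polytope P" "P \<subseteq> X" "y \<in> P" "\<forall>\<^sub>F z in nhds y. z \<in> X \<longrightarrow> z \<in> P"
      using polytope_neighbourhood[OF assms(2)] y YX by blast
    obtain V where V: "finite V" "P = convex hull V"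
      using P(1) unfolding polytope_def by blast
    have "\<forall>\<^sub>F t in at_right 0. y + t *\<^sub>R (v - y) \<in> W \<inter> Y" if "v \<in> V" for v
    proof -
      have "v \<in> X" using that V(2) P(2) hull_subset[of V convex] by blast
      then have "\<forall>\<^sub>F t in at_right 0. y + t *\<^sub>R (v - y) \<in> Y"
        by (rule linearly_openin_eventually[OF assms(1,3) y])
      moreover have "((\<lambda>t. y + t *\<^sub>R (v - y)) \<longlongrightarrow> y + 0 *\<^sub>R (v - y)) (at_right 0)"
        by (intro tendsto_intros)
      then have "\<forall>\<^sub>F t in at_right 0. y + t *\<^sub>R (v - y) \<in> W"
        by (rule topological_tendstoD) (use W in auto)
      ultimately show ?thesis by eventually_elim blast
    qed
    \<comment> \<open>Finiteness of \<open>V\<close> makes one \<open>t\<close> serve all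
      vertices.\<close>
    then have "\<forall>\<^sub>F t in at_right 0. \<forall>v\<in>V. y + t *\<^sub>R (v - y) \<in> W \<inter> Y"
      using V(1) by (simp add: eventually_ball_finite)
    moreover have "\<forall>\<^sub>F t::real in at_right 0. 0 < t"
      by (rule eventually_at_right_less)
    ultimately have "\<forall>\<^sub>F t in at_right 0. 0 < t \<and> (\<forall>v\<in>V. y + t *\<^sub>R (v - y) \<in> W \<inter> Y)"
      by eventually_elim blast
    then obtain t :: real where t: "0 < t" "\<forall>v\<in>V. y + t *\<^sub>R (v - y) \<in> W \<inter> Y"
      using eventually_happens trivial_limit_at_right_real by blast
    \<comment> \<open>The homothety with centre \<open>y\<close> and ratio \<open>t\<close>, in the
      affine form in which it commutes with convex hulls.\<close>
    define f where "f = (\<lambda>v. (y - t *\<^sub>R y) + t *\<^sub>R v)"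
    have f_eq: "f v = y + t *\<^sub>R (v - y)" for v by (simp add: f_def algebra_simps)
    have "f ` V \<subseteq> W \<inter> Y" using t(2) by (auto simp: f_eq)
    then have "convex hull (f ` V) \<subseteq> W \<inter> Y" using W(3) by (rule hull_minimal)
    then have fP: "f ` P \<subseteq> Y"
      unfolding f_def V(2) by (simp add: convex_hull_affinity)
    \<comment> \<open>Scaling by \<open>1 / t\<close> inverts \<open>f\<close>: a point of
      \<open>P\<close> near \<open>y\<close> has its preimage in \<open>P\<close>, so it lies in
      \<open>f\<close> applied to \<open>P\<close>, hence in \<open>Y\<close>.\<close>
    have "\<forall>\<^sub>F z in nhds y. z \<in> P \<longrightarrow> y + (1 / t) *\<^sub>R (z - y) \<in> P"
      using P(1,3) t(1) by (intro polyhedron_locally_conic polytope_imp_polyhedron) auto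
    with P(4) show ?thesis
    proof eventually_elim
      case (elim z)
      show ?case
      proof
        assume "z \<in> X"
        then have "f (y + (1 / t) *\<^sub>R (z - y)) \<in> Y" using elim fP by blast
        then show "z \<in> Y" using t(1) by (simp add: f_eq)
      qed
    qed
  qed
  show ?thesis
  proof (rule openin_subopen[THEN iffD2], rule ballI)
    fix y assume y: "y \<in> Y"
    obtain T where T: "open T" "y \<in> T" "\<forall>z\<in>T. z \<in> X \<longrightarrow> z \<in> Y"
      using nhds[OF y] unfolding eventually_nhds by metis
    have "openin (top_of_set X) (X \<inter> T)" using T(1) by (rule openin_open_Int)
    moreover have "y \<in> X \<inter> T" "X \<inter> T \<subseteq> Y" using T(2,3) y YX by auto
    ultimately show "\<exists>T. openin (top_of_set X) T \<and> y \<in> T \<and> T \<subseteq> Y" by metis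
  qed
qed

section \<open>Convex indifference\<close>

lemma convex_imp_locally_convex: "convex Y \<Longrightarrow> locally_convex Y"
  unfolding locally_convex_def by (metis Int_UNIV_left UNIV_I convex_UNIV open_UNIV)

text \<open>Meant for a weak section \<open>S\<close>, its strict section \<open>P\<close> and the
  indifference class \<open>C\<close>. On a segment avoiding \<open>C\<close> the sets
  \<open>P\<close> and \<open>S\<close> agree, so the trace of \<open>P\<close> is clopen, and by
  connectedness it is empty or everything. Small balls meet \<open>X\<close> in convex sets, so
  membership in \<open>P\<close> is locally constant off \<open>C\<close>.\<close>

lemma segmentwise_clopen_imp_open_and_closed:
  assumes X: "convex X" and S: "linearly_closedin X S" and P: "linearly_openin X P"
    and C: "closedin (top_of_set X) C" and PC: "P = S - C" and CS: "C \<subseteq> S"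
  shows "openin (top_of_set X) P" "closedin (top_of_set X) S"
proof -
  have const: "\<exists>T. openin (top_of_set X) T \<and> y \<in> T \<and> T \<inter> C = {} \<and> (\<forall>z\<in>T. z \<in> P \<longleftrightarrow> y \<in> P)"
    if y: "y \<in> X - C" for y
  proof -
    have "openin (top_of_set X) (X - C)" using C by (simp add: openin_diff)
    then obtain e where e: "e > 0" "ball y e \<inter> X \<subseteq> X - C"
      using y unfolding openin_contains_ball by blast
    have "z \<in> P \<longleftrightarrow> y \<in> P" if z: "z \<in> ball y e \<inter> X" for z
    proof -
      let ?s = "closed_segment y z"
      have "?s \<subseteq> ball y e \<inter> X"
        using z y e(1) X by (intro closed_segment_subset convex_Int) auto
      then have eq: "P \<inter> ?s = S \<inter> ?s" using e(2) PC by blast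
      have "openin (top_of_set ?s) (P \<inter> ?s)"
        using linearly_openin_segment[OF X P] y z by blast
      moreover have "closedin (top_of_set ?s) (P \<inter> ?s)"
        unfolding eq using linearly_closedin_segment[OF X S] y z by blast
      ultimately have "P \<inter> ?s = {} \<or> P \<inter> ?s = ?s"
        using connected_segment connected_clopen by blast
      then show ?thesis using ends_in_segment by blast
    qed
    moreover have "openin (top_of_set X) (ball y e \<inter> X)"
      by (simp add: Int_commute openin_open_Int)
    moreover have "y \<in> ball y e \<inter> X" "(ball y e \<inter> X) \<inter> C = {}"
      using y e by auto
    ultimately show ?thesis by blast
  qed
  have SX: "S \<subseteq> X" using S unfolding linearly_closedin_def by blast
  show "openin (top_of_set X) P"
  proof (rule openin_subopen[THEN iffD2], rule ballI)
    fix y assume "y \<in> P"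
    then show "\<exists>T. openin (top_of_set X) T \<and> y \<in> T \<and> T \<subseteq> P"
      using const[of y] PC SX by blast
  qed
  have "openin (top_of_set X) (X - S)"
  proof (rule openin_subopen[THEN iffD2], rule ballI)
    fix y assume "y \<in> X - S"
    \<comment> \<open>Since \<open>C\<close> lies in \<open>S\<close>, the point \<open>y\<close> is
      outside \<open>C\<close>; a neighbourhood missing both \<open>P\<close> and \<open>C\<close>
      misses \<open>S\<close>.\<close>
    then obtain T where T: "openin (top_of_set X) T" "y \<in> T" "T \<inter> C = {}" "\<forall>z\<in>T. z \<notin> P"
      using const[of y] PC CS by blast
    have "T \<subseteq> X" using openin_imp_subset[OF T(1)] .
    then show "\<exists>T. openin (top_of_set X) T \<and> y \<in> T \<and> T \<subseteq> X - S"
      using T PC by blast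
  qed
  then show "closedin (top_of_set X) S"
    using SX by (simp add: closedin_def)
qed

text \<open>Convex indifference applies to two indifferent points, so transitivity is used twice:
  through \<open>x\<close> to compare \<open>y\<close> with \<open>z\<close>, and through
  \<open>y\<close> to bring the mixture back to the class of \<open>x\<close>.\<close>

lemma convex_indifference_class:
  assumes "convex X" "convex_indifference X R" "transp_on X (indiff_part R)" "x \<in> X"
  shows "convex (upper_section X R x \<inter> lower_section X R x)"
proof -
  define I where "I = {y \<in> X. indiff_part R x y}"
  have I: "y \<in> I \<longleftrightarrow> y \<in> X \<and> indiff_part R x y" for y by (simp add: I_def)
  have "(1 - u) *\<^sub>R y + u *\<^sub>R z \<in> I"
    if yz: "y \<in> I" "z \<in> I" and u: "0 < u" "u < 1" for y z u
  proof -
    let ?w = "(1 - u) *\<^sub>R y + u *\<^sub>R z"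
    have w: "?w \<in> X" using convexD_alt[OF assms(1)] yz u by (simp add: I)
    have "indiff_part R y x" using yz(1) by (simp add: I indiff_part_def)
    then have "indiff_part R y z"
      using transp_onD[OF assms(3) _ assms(4)] yz I by blast
    \<comment> \<open>In \<open>convex_indifference\<close> the weight belongs to the first point,
      which here is \<open>y\<close>.\<close>
    moreover have "0 < 1 - u \<and> 1 - u < 1" using u by simp
    ultimately have "indiff_part R y ((1 - u) *\<^sub>R y + (1 - (1 - u)) *\<^sub>R z)"
      using assms(2) yz I unfolding convex_indifference_def by blast
    then have "indiff_part R y ?w" by simp
    then show ?thesis
      using transp_onD[OF assms(3,4) _ w] yz(1) w I by blast
  qed
  \<comment> \<open>The weights so far lie strictly between 0 and 1; the endpoints are added
    afterwards.\<close>
  then have "open_segment y z \<subseteq> I" if "y \<in> I" "z \<in> I" for y z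
    using that by (intro subsetI) (metis in_segment(2))
  then have "closed_segment y z \<subseteq> I" if "y \<in> I" "z \<in> I" for y z
    using that by (simp add: closed_segment_eq_open)
  then have "convex I"
    by (simp add: convex_contains_segment)
  moreover have "upper_section X R x \<inter> lower_section X R x = I"
    by (auto simp: I_def upper_section_def lower_section_def indiff_part_def)
  ultimately show ?thesis by simp
qed

section \<open>Continuity of preferences\<close>

lemma linearly_continuous_pref_iff:
  "linearly_continuous_pref X R \<longleftrightarrow>
     (\<forall>x\<in>X. linearly_closedin X (upper_section X R x) \<and>
            linearly_closedin X (lower_section X R x) \<and>
            linearly_openin X (upper_section X (strict_part R) x) \<and>
            linearly_openin X (lower_section X (strict_part R) x))"
proof -
  have "upper_section X Q x \<subseteq> X" "lower_section X Q x \<subseteq> X" for Q :: "'a \<Rightarrow> 'a \<Rightarrow> bool" and x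
    by (auto simp: upper_section_def lower_section_def)
  then show ?thesis
    unfolding linearly_continuous_pref_def linearly_closedin_def linearly_openin_def by blast
qed

lemma continuous_pref_imp_linearly_continuous_pref:
  "continuous_pref X R \<Longrightarrow> linearly_continuous_pref X R"
  unfolding continuous_pref_def linearly_continuous_pref_iff
  using closedin_imp_linearly_closedin openin_imp_linearly_openin by blast

text \<open>Completeness turns each lower section into the complement in \<open>X\<close> of an
  upper one, exchanging weak and strict, and hence closed and open.\<close>

lemma continuous_pref_if_complete:
  assumes "complete_on X R"
    and "\<And>x. x \<in> X \<Longrightarrow> closedin (top_of_set X) (upper_section X R x)"
    and "\<And>x. x \<in> X \<Longrightarrow> openin (top_of_set X) (upper_section X (strict_part R) x)"
  shows "continuous_pref X R"
proof -
  have "lower_section X R x = X - upper_section X (strict_part R) x"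
    "lower_section X (strict_part R) x = X - upper_section X R x" if "x \<in> X" for x
    using assms(1) that
    by (auto simp: complete_on_def lower_section_def upper_section_def strict_part_def)
  then show ?thesis
    using assms(2,3) by (simp add: continuous_pref_def openin_diff closedin_diff)
qed

lemma continuous_pref_if_convex_indifference:
  assumes "convex X" "linearly_continuous_pref X R" "convex_indifference X R"
    "transp_on X (indiff_part R)"
  shows "continuous_pref X R"
  unfolding continuous_pref_def
proof
  fix x assume x: "x \<in> X"
  let ?C = "upper_section X R x \<inter> lower_section X R x"
  have lin: "linearly_closedin X (upper_section X R x)" "linearly_closedin X (lower_section X R x)"
    "linearly_openin X (upper_section X (strict_part R) x)"
    "linearly_openin X (lower_section X (strict_part R) x)"
    using assms(2) x unfolding linearly_continuous_pref_iff by blast+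
  \<comment> \<open>The class is convex and is an intersection of two sets closed along lines, so
    the closedness criterion for locally convex sets applies.\<close>
  have C: "closedin (top_of_set X) ?C"
    using convex_indifference_class[OF assms(1,3,4) x] lin
    by (intro linearly_closedin_imp_closedin[OF assms(1)] linearly_closedin_Int
        convex_imp_locally_convex)
  have "upper_section X (strict_part R) x = upper_section X R x - ?C"
    "lower_section X (strict_part R) x = lower_section X R x - ?C"
    by (auto simp: upper_section_def lower_section_def strict_part_def)
  then show "closedin (top_of_set X) (upper_section X R x) \<and>
        closedin (top_of_set X) (lower_section X R x) \<and>
        openin (top_of_set X) (upper_section X (strict_part R) x) \<and>
        openin (top_of_set X) (lower_section X (strict_part R) x)"
    using segmentwise_clopen_imp_open_and_closed[OF assms(1) lin(1,3) C]
      segmentwise_clopen_imp_open_and_closed[OF assms(1) lin(2,4) C] by blast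
qed

theorem theorem4:
  fixes X :: "(real ^ 'n) set" and R :: "real ^ 'n \<Rightarrow> real ^ 'n \<Rightarrow> bool"
  assumes "convex X"
    and "open X \<or> polyhedron X"
    and "(complete_on X R \<and>
            locally_convex_upper_sections X R \<and>
            locally_convex_upper_sections X (strict_part R))
         \<or> (locally_convex_upper_sections X R \<and>
            locally_convex_lower_sections X R \<and>
            locally_convex_upper_sections X (strict_part R) \<and>
            locally_convex_lower_sections X (strict_part R))
         \<or> (reflp_on X R \<and> convex_indifference X R \<and> transp_on X (indiff_part R))"
  shows "linearly_continuous_pref X R \<longleftrightarrow> continuous_pref X R"
proof
  assume lin: "linearly_continuous_pref X R"
  note cl = linearly_closedin_imp_closedin[OF assms(1)]
    and op = linearly_openin_imp_openin[OF assms(1,2)]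
  from assms(3) show "continuous_pref X R"
  proof (elim disjE conjE)
    assume "complete_on X R" "locally_convex_upper_sections X R"
      "locally_convex_upper_sections X (strict_part R)"
    then show ?thesis
      using lin unfolding linearly_continuous_pref_iff locally_convex_upper_sections_def
      by (intro continuous_pref_if_complete cl op) auto
  next
    assume "locally_convex_upper_sections X R" "locally_convex_lower_sections X R"
      "locally_convex_upper_sections X (strict_part R)"
      "locally_convex_lower_sections X (strict_part R)"
    then show ?thesis
      using lin unfolding linearly_continuous_pref_iff locally_convex_upper_sections_def
        locally_convex_lower_sections_def continuous_pref_def
      by (intro ballI conjI cl op) auto
  next
    assume "convex_indifference X R" "transp_on X (indiff_part R)"
    then show ?thesis
      using continuous_pref_if_convex_indifference assms(1) lin by blast
  qed
qed (rule continuous_pref_imp_linearly_continuous_pref)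

end
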